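(* Let $G$ be a finite group. Then $|G|$ is the smallest positive integer $m$ such that the class function $g\mapsto m\,o(g)$ on $G$ is a generalized character of $G$. Furthermore, the class function $\Xi_{(G)}$ on $G$ defined by $\Xi_{(G)}(g)=|G|\,o(g)$ for $g\in G$ is a $\mathbb{Z}$-linear combination of the characters $(1_C)^G$, where $C$ runs over the cyclic subgroups of $G$.
   Context: For $g\in G$, $o(g)$ denotes the order of the element $g$. Characters are complex characters. A generalized character of $G$ is a $\mathbb{Z}$-linear combination of irreducible complex characters of $G$. For a subgroup $C\leq G$, $1_C$ is the trivial character of $C$ and $(1_C)^G$ is the character of $G$ induced from $1_C$. *)

theory Defs
  imports
    "HOL-Algebra.Elementary_Groups"
    "HOL-Algebra.Multiplicative_Group"
    "Jordan_Normal_Form.VS_Connect"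
begin

definition mat_trace :: "complex mat \<Rightarrow> complex" where
  "mat_trace A = (\<Sum>i<dim_row A. A $$ (i, i))"

text \<open>A complex representation of degree \<open>n\<close>: a homomorphism into the unit group of the
  ring of complex \<open>n \<times> n\<close> matrices, i.e. into $GL_n(\mathbb{C})$.\<close>

definition representation ::
  "('a, 'b) monoid_scheme \<Rightarrow> nat \<Rightarrow> ('a \<Rightarrow> complex mat) \<Rightarrow> bool" where
  "representation G n \<rho> \<longleftrightarrow> \<rho> \<in> hom G (units_of (ring_mat TYPE(complex) n ()))"

definition irreducible_representation ::
  "('a, 'b) monoid_scheme \<Rightarrow> nat \<Rightarrow> ('a \<Rightarrow> complex mat) \<Rightarrow> bool" where
  "irreducible_representation G n \<rho> \<longleftrightarrow>
     representation G n \<rho> \<and> 0 < n \<and>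
     (\<forall>W. VectorSpace.subspace class_ring W (module_vec TYPE(complex) n) \<and>
          (\<forall>g\<in>carrier G. \<forall>w\<in>W. \<rho> g *\<^sub>v w \<in> W)
        \<longrightarrow> W = {0\<^sub>v n} \<or> W = carrier_vec n)"

text \<open>Characters are extensional (\<open>undefined\<close> off the carrier), so that two of them are equal
  as HOL functions iff they agree on the group.\<close>

definition rep_character ::
  "('a, 'b) monoid_scheme \<Rightarrow> ('a \<Rightarrow> complex mat) \<Rightarrow> 'a \<Rightarrow> complex" where
  "rep_character G \<rho> = (\<lambda>g\<in>carrier G. mat_trace (\<rho> g))"

definition irr_characters :: "('a, 'b) monoid_scheme \<Rightarrow> ('a \<Rightarrow> complex) set" where
  "irr_characters G = {rep_character G \<rho> | n \<rho>. irreducible_representation G n \<rho>}"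

definition int_combination_on ::
  "'a set \<Rightarrow> ('a \<Rightarrow> complex) set \<Rightarrow> ('a \<Rightarrow> complex) \<Rightarrow> bool" where
  "int_combination_on A X f \<longleftrightarrow>
     (\<exists>S (c :: ('a \<Rightarrow> complex) \<Rightarrow> int). finite S \<and> S \<subseteq> X \<and>
        (\<forall>g\<in>A. f g = (\<Sum>\<chi>\<in>S. of_int (c \<chi>) * \<chi> g)))"

definition generalized_character ::
  "('a, 'b) monoid_scheme \<Rightarrow> ('a \<Rightarrow> complex) \<Rightarrow> bool" where
  "generalized_character G f \<longleftrightarrow> int_combination_on (carrier G) (irr_characters G) f"

definition trivial_character :: "'a set \<Rightarrow> 'a \<Rightarrow> complex" where
  "trivial_character C = (\<lambda>h\<in>C. 1)"

text \<open>The usual formula for induction from a subgroup \<open>H\<close> of a finite group: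
  $\varphi^G(g) = |H|^{-1} \sum_{x \in G} \varphi^\circ(x g x^{-1})$, where $\varphi^\circ$ is
  $\varphi$ extended by zero outside \<open>H\<close>.\<close>

definition induced_character ::
  "('a, 'b) monoid_scheme \<Rightarrow> 'a set \<Rightarrow> ('a \<Rightarrow> complex) \<Rightarrow> 'a \<Rightarrow> complex" where
  "induced_character G H \<phi> =
     (\<lambda>g\<in>carrier G.
        (\<Sum>x\<in>carrier G.
           let y = x \<otimes>\<^bsub>G\<^esub> g \<otimes>\<^bsub>G\<^esub> inv\<^bsub>G\<^esub> x in if y \<in> H then \<phi> y else 0) / of_nat (card H))"

definition cyclic_subgroups :: "('a, 'b) monoid_scheme \<Rightarrow> 'a set set" where
  "cyclic_subgroups G = {C. subgroup C G \<and> cyclic_group (G\<lparr>carrier := C\<rparr>)}"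

definition Xi :: "('a, 'b) monoid_scheme \<Rightarrow> 'a \<Rightarrow> complex" where
  "Xi G g = of_nat (Coset.order G) * of_nat (group.ord G g)"

end

(*
  Lower bound: if m o(g) is a generalized character, then its sum over a subgroup P is divisible
  by |P|. For a Sylow p-subgroup P the sum of the orders is congruent to 1 modulo p, so |P|
  divides m; hence |G| divides m.

  Existence: for a cyclic subgroup C let T_C(g) be the number of x in G such that x g x^-1
  generates C. Then |C| (1_C)^G is the sum of T_B over all B <= C, so by induction on |C| every
  T_C is an integer combination of characters (1_B)^G with B cyclic; and |G| o(g) is the sum of
  |C| T_C(g) over all C, since each x in G contributes o(x g x^-1) = o(g).
*)

theory Submission
  imports Defs "Jordan_Normal_Form.Schur_Decomposition" "Jordan_Normal_Form.DL_Rank"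
    "HOL-Algebra.Sylow"
begin

subsection \<open>Matrices and invariant subspaces\<close>

text \<open>Divisibility of a sum over P by |P| says that the inner product of the restricted
  character with 1_P is an integer; it is obtained from the sum of the representing matrices over P,
  whose eigenvalues are only 0 and |P|. The test has to be made on Sylow subgroups: on G itself it
  is too weak, since in the cyclic group of order 6 the orders sum to 21, which is not prime to 6.

  For existence the induced characters must still be traced back to irreducible ones. (1_C)^G is the
  permutation character on the right cosets of C, and the character of any matrix representation can
  be split along invariant subspaces until only irreducible pieces remain. A block triangular form
  is enough for this, because the trace sees only the diagonal blocks.

  The relation between |C| (1_C)^G and the T_B comes from sorting the elements x by the cyclic
  subgroup that x g x^-1 generates. The weight |C| of T_C reflects that an element has as many
  powers as its order.\<close>

text \<open>The columns of \<open>P\<close> are a basis of \<open>W\<close> followed by vectors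
  completing it to a basis of the whole space, and \<open>Q\<close> reads off coordinates in that
  basis. The two boundary clauses for \<open>k\<close> later turn a proper nonzero \<open>W\<close>
  into \<open>0 < k\<close> and \<open>k < n\<close>.\<close>

lemma (in vec_space) adapted_basis:
  assumes W: "subspace class_ring W V"
  obtains k P Q where "k \<le> n" "P \<in> carrier_mat n n" "Q \<in> carrier_mat n n"
    "P * Q = 1\<^sub>m n" "Q * P = 1\<^sub>m n"
    "\<forall>j<k. col P j \<in> W" "\<forall>w\<in>W. \<forall>i. k \<le> i \<longrightarrow> i < n \<longrightarrow> (Q *\<^sub>v w) $ i = 0"
    "k = 0 \<longrightarrow> W = {0\<^sub>v n}" "k = n \<longrightarrow> W = carrier_vec n"
proof -
  from W have WV: "W \<subseteq> carrier_vec n" and sub: "submodule class_ring W V"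
    unfolding subspace_def submodule_def by auto
  have bound: "finite A \<and> card A \<le> n" if "A \<subseteq> carrier_vec n" "lin_indpt A" for A
    using li_le_dim[OF fin_dim _ that(2)] that(1) dim_is_n by auto
  have li_empty: "lin_indpt {}" by (auto simp: lin_dep_def)
  obtain B where finB: "finite B" and maxB: "maximal B (\<lambda>S. S \<subseteq> W \<and> lin_indpt S)"
    using maximal_exists[of "\<lambda>S. S \<subseteq> W \<and> lin_indpt S" n "{}"] bound WV li_empty
    by (meson dual_order.trans empty_subsetI)
  then have BW: "B \<subseteq> W" and liB: "lin_indpt B" by (auto simp: maximal_def)
  have spanB: "span B = W"
  proof (intro subset_antisym subsetI)
    show "w \<in> W" if "w \<in> span B" for w
      using span_is_subset[OF BW sub] that by auto
    show "w \<in> span B" if w: "w \<in> W" for w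
    proof (cases "w \<in> B")
      case True
      then show ?thesis using in_own_span[of B] BW WV by auto
    next
      case False
      \<comment> \<open>Maximality of \<open>B\<close> inside \<open>W\<close> makes every further
        vector of \<open>W\<close> dependent on \<open>B\<close>.\<close>
      have "lin_dep (B \<union> {w})"
      proof (rule ccontr)
        assume "lin_indpt (B \<union> {w})"
        then have "B \<union> {w} = B" using maxB BW w unfolding maximal_def by blast
        then show False using False by auto
      qed
      then show ?thesis using lin_dep_iff_in_span[of B w] BW WV liB w False by auto
    qed
  qed
  obtain D where finD: "finite D"
    and maxD: "maximal D (\<lambda>S. B \<subseteq> S \<and> S \<subseteq> carrier_vec n \<and> lin_indpt S)"
    using maximal_exists[of "\<lambda>S. B \<subseteq> S \<and> S \<subseteq> carrier_vec n \<and> lin_indpt S" n B] bound BW WV liB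
    by (meson dual_order.trans subset_refl)
  then have BD: "B \<subseteq> D" and DV: "D \<subseteq> carrier_vec n" and liD: "lin_indpt D"
    by (auto simp: maximal_def)
  \<comment> \<open>Every set above \<open>D\<close> already contains \<open>B\<close>, so
    maximality among the sets extending \<open>B\<close> is maximality among all independent
    sets.\<close>
  have "maximal D (\<lambda>S. S \<subseteq> carrier_vec n \<and> lin_indpt S)"
    using maxD BD unfolding maximal_def by (meson subset_trans)
  then have basisD: "basis D" using max_li_is_basis by auto
  then have cardD: "card D = n" using dim_basis[OF finD] dim_is_n by auto
  obtain bs where bs: "set bs = B" "distinct bs" using finite_distinct_list[OF finB] by auto
  obtain cs where cs: "set cs = D - B" "distinct cs"
    using finite_distinct_list[of "D - B"] finD by auto
  define ds where "ds = bs @ cs"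
  have ds: "set ds = D" "distinct ds" using bs cs BD by (auto simp: ds_def)
  then have lends: "length ds = n" using cardD distinct_card by fastforce
  define k where "k = length bs"
  have kB: "k = card B" using bs distinct_card k_def by fastforce
  define P where "P = mat_of_cols n ds"
  have P: "P \<in> carrier_mat n n" using lends by (auto simp: P_def)
  have colsP: "cols P = ds" unfolding P_def by (rule cols_mat_of_cols) (use ds DV in auto)
  have colP: "col P j = ds ! j" if "j < n" for j
    using colsP that P by (metis carrier_matD(2) cols_nth)
  have "rank P = n" using lin_indpt_full_rank[OF P] colsP ds liD by auto
  then have "det P \<noteq> 0" using det_rank_iff[OF P] by auto
  then obtain Q where Q: "Q \<in> carrier_mat n n" "P * Q = 1\<^sub>m n" "Q * P = 1\<^sub>m n"
    using det_non_zero_imp_unit[OF P, of "()"] unfolding Units_def by (auto simp: ring_mat_simps)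
  have kn: "k \<le> n" using lends by (simp add: k_def ds_def)
  have PW: "col P j \<in> W" if "j < k" for j
      using that colP[of j] lends bs BW by (auto simp: k_def ds_def nth_append)
  have QW: "(Q *\<^sub>v w) $ i = 0" if w: "w \<in> W" and i: "k \<le> i" "i < n" for w i
    proof -
      obtain a where a: "w = lincomb a B"
        using w spanB finite_span[OF finB] BW WV by auto
      \<comment> \<open>\<open>b\<close> gives the coordinates of \<open>w\<close> in the enlarged
        basis. Since \<open>ds\<close> lists \<open>B\<close> first, the positions from
        \<open>k\<close> on belong to \<open>D - B\<close>, where \<open>b\<close> vanishes.\<close>
      define b where "b v = (if v \<in> B then a v else 0)" for v
      have "w = lincomb b D"
      proof (rule eq_vecI)
        show "dim_vec w = dim_vec (lincomb b D)"
          using w WV lincomb_dim[OF finD DV] by auto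
        fix l assume "l < dim_vec (lincomb b D)"
        then have l: "l < n" using lincomb_dim[OF finD DV] by auto
        have "lincomb b D $ l = (\<Sum>v\<in>D. b v * v $ l)" by (rule lincomb_index[OF l DV])
        also have "\<dots> = (\<Sum>v\<in>B. a v * v $ l)"
          by (rule sum.mono_neutral_cong_right) (use finD BD in \<open>auto simp: b_def\<close>)
        also have "\<dots> = w $ l" using lincomb_index[OF l, of B a] BW WV a by auto
        finally show "w $ l = lincomb b D $ l" by simp
      qed
      also have "\<dots> = P *\<^sub>v vec n (\<lambda>i. b (col P i))"
        using mat_mult_eq_lincomb[OF P] colsP ds by auto
      finally have "Q *\<^sub>v w = (Q * P) *\<^sub>v vec n (\<lambda>i. b (col P i))"
        using assoc_mult_mat_vec[OF Q(1) P] by auto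
      then have "(Q *\<^sub>v w) $ i = b (col P i)" using Q i by auto
      moreover have "ds ! i \<in> D - B"
      proof -
        have "ds ! i = cs ! (i - k)" using i(1) by (simp add: ds_def k_def nth_append)
        moreover have "i - k < length cs" using i lends by (simp add: ds_def k_def)
        ultimately show ?thesis using cs(1) nth_mem by metis
      qed
      ultimately show ?thesis using colP[OF i(2)] by (simp add: b_def)
    qed
  have k0: "W = {0\<^sub>v n}" if "k = 0"
    proof -
      have "B = {}" using that kB finB by simp
      then show ?thesis using spanB span_empty by simp
    qed
  have k_n: "W = carrier_vec n" if "k = n"
    proof -
      have "B = D" using card_subset_eq[OF finD BD] kB that cardD by simp
      then show ?thesis using spanB basisD unfolding basis_def by simp
    qed
  show ?thesis by (rule that[of k P Q]) (use kn P Q PW QW k0 k_n in blast)+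
qed

section \<open>Traces of complex matrices\<close>

lemma mat_trace_mult_comm:
  assumes "A \<in> carrier_mat n m" "B \<in> carrier_mat m n"
  shows "mat_trace (A * B) = mat_trace (B * A)"
proof -
  have "mat_trace (A * B) = (\<Sum>i<n. \<Sum>j<m. A $$ (i, j) * B $$ (j, i))"
    using assms by (simp add: mat_trace_def scalar_prod_def atLeast0LessThan)
  also have "\<dots> = (\<Sum>j<m. \<Sum>i<n. B $$ (j, i) * A $$ (i, j))"
    by (subst sum.swap) (simp add: mult.commute)
  also have "\<dots> = mat_trace (B * A)"
    using assms by (simp add: mat_trace_def scalar_prod_def atLeast0LessThan)
  finally show ?thesis .
qed

lemma mat_trace_conj:
  assumes "A \<in> carrier_mat n n" "P \<in> carrier_mat n n" "Q \<in> carrier_mat n n" "P * Q = 1\<^sub>m n"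
  shows "mat_trace (Q * A * P) = mat_trace A"
proof -
  have "mat_trace (Q * A * P) = mat_trace (P * (Q * A))"
    by (rule mat_trace_mult_comm[of _ n n]) (use assms in auto)
  also have "P * (Q * A) = A" using assms by (simp flip: assoc_mult_mat)
  finally show ?thesis .
qed

text \<open>If \<open>A\<^sup>2 = c A\<close>, the eigenvalues of \<open>A\<close> all lie in \<open>{0, c}\<close>.\<close>

lemma mat_trace_square_eq_smult:
  assumes A: "A \<in> carrier_mat n n" and sq: "A * A = c \<cdot>\<^sub>m A"
  obtains m :: nat where "mat_trace A = c * of_nat m"
proof -
  \<comment> \<open>The characteristic polynomial splits over the complex numbers, which is what
    triangularisation asks for.\<close>
  obtain es where "char_poly A = (\<Prod>e\<leftarrow>es. [:- e, 1:])" using char_poly_factorized[OF A] by auto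
  then obtain B where B: "B \<in> carrier_mat n n" and upper: "upper_triangular B"
    and sim: "similar_mat A B"
    using schur_decomposition_exists[OF A] by auto
  obtain P Q where PQ: "P \<in> carrier_mat n n" "Q \<in> carrier_mat n n"
    "P * Q = 1\<^sub>m n" "Q * P = 1\<^sub>m n" and AB: "A = P * B * Q"
    using sim similar_mat_witD2[OF A] unfolding similar_mat_def by metis
  note assoc = assoc_mult_mat[of _ n n _ n _ n]
  have "Q * A * P = (Q * P) * B * (Q * P)"
    unfolding AB using PQ(1,2) B by (simp add: assoc)
  then have B_eq: "B = Q * A * P" using PQ B by simp
  have "B * B = Q * A * (P * Q) * A * P"
    unfolding B_eq using PQ(1,2) A by (simp add: assoc)
  also have "\<dots> = Q * (A * A) * P"
    unfolding PQ(3) using PQ(1,2) A by (simp add: assoc)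
  also have "\<dots> = c \<cdot>\<^sub>m B"
    unfolding sq B_eq using PQ(1,2) A
    by (simp add: mult_smult_distrib[of _ n n _ n] mult_smult_assoc_mat[of _ n n _ n])
  finally have BB: "B * B = c \<cdot>\<^sub>m B" .
  \<comment> \<open>By triangularity the diagonal of \<open>B * B\<close> consists of the squares of
    the diagonal entries, so each entry b satisfies b^2 = c b.\<close>
  have diag: "B $$ (i, i) = (if B $$ (i, i) = 0 then 0 else c)" if i: "i < n" for i
  proof -
    have "c * B $$ (i, i) = (B * B) $$ (i, i)" using BB B i by auto
    also have "\<dots> = (\<Sum>l<n. B $$ (i, l) * B $$ (l, i))"
      using B i by (auto simp: scalar_prod_def atLeast0LessThan)
    also have "\<dots> = (\<Sum>l\<in>{i}. B $$ (i, l) * B $$ (l, i))"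
    proof (rule sum.mono_neutral_right)
      show "\<forall>l\<in>{..<n} - {i}. B $$ (i, l) * B $$ (l, i) = 0"
      proof
        fix l assume "l \<in> {..<n} - {i}"
        then have "l < i \<or> i < l" "l < n" by auto
        then show "B $$ (i, l) * B $$ (l, i) = 0"
          using upper B i unfolding upper_triangular_def by auto
      qed
    qed (use i in auto)
    finally show ?thesis by auto
  qed
  have "mat_trace A = mat_trace B" using mat_trace_conj[OF A PQ(1-3)] B_eq by simp
  also have "\<dots> = (\<Sum>i<n. if B $$ (i, i) = 0 then 0 else c)"
    unfolding mat_trace_def using B diag by (auto intro!: sum.cong)
  also have "\<dots> = (\<Sum>i\<in>{i\<in>{..<n}. B $$ (i, i) \<noteq> 0}. c)"
    by (rule sum.mono_neutral_cong_right) auto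
  also have "\<dots> = c * of_nat (card {i\<in>{..<n}. B $$ (i, i) \<noteq> 0})" by simp
  finally show ?thesis by (rule that)
qed

subsection \<open>Generalized characters\<close>

lemma int_combination_on_cong:
  assumes "int_combination_on A X f" "\<And>g. g \<in> A \<Longrightarrow> f g = f' g"
  shows "int_combination_on A X f'"
  using assms unfolding int_combination_on_def by metis

lemma int_combination_on_zero: "int_combination_on A X (\<lambda>_. 0)"
  unfolding int_combination_on_def by (rule exI[of _ "{}"]) simp

lemma int_combination_on_member: "\<chi> \<in> X \<Longrightarrow> int_combination_on A X \<chi>"
  unfolding int_combination_on_def by (rule exI[of _ "{\<chi>}"], rule exI[of _ "\<lambda>_. 1"]) simp

lemma int_combination_on_add:
  assumes "int_combination_on A X f" "int_combination_on A X f'"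
  shows "int_combination_on A X (\<lambda>g. f g + f' g)"
proof -
  obtain S and c :: "('a \<Rightarrow> complex) \<Rightarrow> int" where S: "finite S" "S \<subseteq> X"
    and f: "\<And>g. g \<in> A \<Longrightarrow> f g = (\<Sum>\<chi>\<in>S. of_int (c \<chi>) * \<chi> g)"
    using assms(1) unfolding int_combination_on_def by metis
  obtain S' and c' :: "('a \<Rightarrow> complex) \<Rightarrow> int" where S': "finite S'" "S' \<subseteq> X"
    and f': "\<And>g. g \<in> A \<Longrightarrow> f' g = (\<Sum>\<chi>\<in>S'. of_int (c' \<chi>) * \<chi> g)"
    using assms(2) unfolding int_combination_on_def by metis
  \<comment> \<open>\<open>S\<close> and \<open>S'\<close> may overlap, so both coefficient
    functions are extended by zero to the union before they are added.\<close>
  define d where "d \<chi> = (if \<chi> \<in> S then c \<chi> else 0) + (if \<chi> \<in> S' then c' \<chi> else 0)" for \<chi>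
  have "f g + f' g = (\<Sum>\<chi>\<in>S \<union> S'. of_int (d \<chi>) * \<chi> g)" if g: "g \<in> A" for g
  proof -
    have "f g = (\<Sum>\<chi>\<in>S \<union> S'. of_int (if \<chi> \<in> S then c \<chi> else 0) * \<chi> g)"
      unfolding f[OF g] by (rule sum.mono_neutral_cong_left) (use S S' in auto)
    moreover have "f' g = (\<Sum>\<chi>\<in>S \<union> S'. of_int (if \<chi> \<in> S' then c' \<chi> else 0) * \<chi> g)"
      unfolding f'[OF g] by (rule sum.mono_neutral_cong_left) (use S S' in auto)
    ultimately show ?thesis
      by (simp only: d_def of_int_add distrib_right sum.distrib)
  qed
  then show ?thesis unfolding int_combination_on_def
    using S S' by (intro exI[of _ "S \<union> S'"] exI[of _ d]) auto
qed

lemma int_combination_on_cmult: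
  assumes "int_combination_on A X f"
  shows "int_combination_on A X (\<lambda>g. of_int z * f g)"
proof -
  obtain S and c :: "('a \<Rightarrow> complex) \<Rightarrow> int" where S: "finite S" "S \<subseteq> X"
    and f: "\<And>g. g \<in> A \<Longrightarrow> f g = (\<Sum>\<chi>\<in>S. of_int (c \<chi>) * \<chi> g)"
    using assms unfolding int_combination_on_def by metis
  then show ?thesis unfolding int_combination_on_def
    by (intro exI[of _ S] exI[of _ "\<lambda>\<chi>. z * c \<chi>"]) (simp add: sum_distrib_left mult.assoc)
qed

lemma int_combination_on_sum:
  assumes "\<And>i. i \<in> I \<Longrightarrow> int_combination_on A X (f i)"
  shows "int_combination_on A X (\<lambda>g. \<Sum>i\<in>I. f i g)"
  using assms
  by (induction I rule: infinite_finite_induct)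
    (auto intro: int_combination_on_zero int_combination_on_add)

text \<open>This serves to pass from the characters induced from cyclic subgroups to the irreducible
  characters.\<close>

lemma int_combination_on_trans:
  assumes f: "int_combination_on A X f" and X: "\<And>\<chi>. \<chi> \<in> X \<Longrightarrow> int_combination_on A Y \<chi>"
  shows "int_combination_on A Y f"
proof -
  obtain S and c :: "('a \<Rightarrow> complex) \<Rightarrow> int" where S: "S \<subseteq> X"
    and f: "\<And>g. g \<in> A \<Longrightarrow> f g = (\<Sum>\<chi>\<in>S. of_int (c \<chi>) * \<chi> g)"
    using f unfolding int_combination_on_def by metis
  have "int_combination_on A Y (\<lambda>g. \<Sum>\<chi>\<in>S. of_int (c \<chi>) * \<chi> g)"
    using S X by (intro int_combination_on_sum int_combination_on_cmult) auto
  then show ?thesis by (rule int_combination_on_cong) (simp add: f)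
qed

section \<open>Representations and their decomposition into irreducible pieces\<close>

text \<open>Invertibility of the values follows from the other conditions, with
  \<open>\<rho> (inv g)\<close> as inverse of \<open>\<rho> g\<close>. The value at
  \<open>\<one>\<close> has to be listed: multiplicativity alone would only make it
  idempotent.\<close>

lemma representation_iff:
  fixes G (structure)
  assumes "group G"
  shows "representation G n \<rho> \<longleftrightarrow>
    (\<forall>g\<in>carrier G. \<rho> g \<in> carrier_mat n n) \<and> \<rho> \<one> = 1\<^sub>m n \<and>
    (\<forall>g\<in>carrier G. \<forall>h\<in>carrier G. \<rho> (g \<otimes> h) = \<rho> g * \<rho> h)" (is "_ \<longleftrightarrow> ?rhs")
proof
  interpret group G by fact
  let ?R = "ring_mat TYPE(complex) n ()"
  interpret R: ring ?R by (rule ring_mat)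
  {
    assume hom: "representation G n \<rho>"
    then interpret group_hom G "units_of ?R" \<rho>
      unfolding representation_def
      by (intro group_hom.intro group_hom_axioms.intro R.units_group) (rule assms)
    show ?rhs
    proof (intro conjI ballI)
      show "\<rho> g \<in> carrier_mat n n" if "g \<in> carrier G" for g
        using hom_closed[OF that] by (simp add: units_of_carrier Units_def ring_mat_simps)
      show "\<rho> \<one> = 1\<^sub>m n"
        using hom_one by (simp add: units_of_one ring_mat_simps)
      show "\<rho> (g \<otimes> h) = \<rho> g * \<rho> h" if "g \<in> carrier G" "h \<in> carrier G" for g h
        using hom_mult[OF that] by (simp add: units_of_mult ring_mat_simps)
    qed
  }
  {
    assume rhs: ?rhs
    have "\<rho> g \<in> Units ?R" if g: "g \<in> carrier G" for g
    proof -
      have "\<rho> g * \<rho> (inv g) = 1\<^sub>m n" "\<rho> (inv g) * \<rho> g = 1\<^sub>m n"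
        using rhs g by (metis inv_closed r_inv l_inv)+
      then show ?thesis
        unfolding Units_def ring_mat_simps using rhs g by (auto intro!: bexI[of _ "\<rho> (inv g)"])
    qed
    then show "representation G n \<rho>"
      unfolding representation_def hom_def
      using rhs by (simp add: units_of_carrier units_of_mult ring_mat_simps)
  }
qed

lemma sum_lessThan_add:
  fixes f :: "nat \<Rightarrow> 'a :: comm_monoid_add"
  shows "(\<Sum>l<k+m. f l) = (\<Sum>l<k. f l) + (\<Sum>l<m. f (l + k))"
  by (induction m) (simp_all add: add_ac)

text \<open>In a basis adapted to \<open>W\<close> all matrices are block upper triangular. The
  diagonal blocks are then multiplicative on their own: they describe the action on \<open>W\<close>
  and on the quotient by \<open>W\<close>.\<close>

lemma representation_blocks:
  assumes "group G" and rep: "representation G n \<rho>"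
    and W: "VectorSpace.subspace class_ring W (module_vec TYPE(complex) n)"
    and inv: "\<forall>g\<in>carrier G. \<forall>w\<in>W. \<rho> g *\<^sub>v w \<in> W"
    and proper: "W \<noteq> {0\<^sub>v n}" "W \<noteq> carrier_vec n"
  obtains k \<rho>\<^sub>1 \<rho>\<^sub>2 where "k < n" "0 < k"
    "representation G k \<rho>\<^sub>1" "representation G (n - k) \<rho>\<^sub>2"
    "\<forall>g\<in>carrier G. mat_trace (\<rho> g) = mat_trace (\<rho>\<^sub>1 g) + mat_trace (\<rho>\<^sub>2 g)"
proof -
  interpret group G by fact
  interpret V: vec_space "TYPE(complex)" n .
  obtain k P Q where k: "k \<le> n" and PQ: "P \<in> carrier_mat n n" "Q \<in> carrier_mat n n"
    "P * Q = 1\<^sub>m n" "Q * P = 1\<^sub>m n"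
    and PW: "\<forall>j<k. col P j \<in> W"
    and QW: "\<forall>w\<in>W. \<forall>i. k \<le> i \<longrightarrow> i < n \<longrightarrow> (Q *\<^sub>v w) $ i = 0"
    and k0: "k = 0 \<longrightarrow> W = {0\<^sub>v n}" and kn: "k = n \<longrightarrow> W = carrier_vec n"
    by (rule V.adapted_basis[OF W])
  have rho: "\<And>g. g \<in> carrier G \<Longrightarrow> \<rho> g \<in> carrier_mat n n" "\<rho> \<one>\<^bsub>G\<^esub> = 1\<^sub>m n"
    "\<And>g h. \<lbrakk>g \<in> carrier G; h \<in> carrier G\<rbrakk> \<Longrightarrow> \<rho> (g \<otimes>\<^bsub>G\<^esub> h) = \<rho> g * \<rho> h"
    using rep unfolding representation_iff[OF \<open>group G\<close>] by auto
  define M where "M g = Q * \<rho> g * P" for g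
  note assoc = assoc_mult_mat[of _ n n _ n _ n]
  have M: "M g \<in> carrier_mat n n" if "g \<in> carrier G" for g
    using rho(1)[OF that] PQ by (simp add: M_def)
  have M_one: "M \<one>\<^bsub>G\<^esub> = 1\<^sub>m n" unfolding M_def rho(2) using PQ by simp
  have M_mult: "M (g \<otimes>\<^bsub>G\<^esub> h) = M g * M h" if gh: "g \<in> carrier G" "h \<in> carrier G" for g h
  proof -
    have "M g * M h = Q * \<rho> g * (P * Q) * \<rho> h * P"
      unfolding M_def using PQ(1,2) rho(1)[OF gh(1)] rho(1)[OF gh(2)] by (simp add: assoc)
    also have "\<dots> = Q * (\<rho> g * \<rho> h) * P"
      unfolding PQ(3) using PQ(1,2) rho(1)[OF gh(1)] rho(1)[OF gh(2)] by (simp add: assoc)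
    finally show ?thesis unfolding M_def rho(3)[OF gh] by simp
  qed
  \<comment> \<open>Column \<open>j\<close> of \<open>M g\<close> holds the coordinates of the image
    of the \<open>j\<close>-th basis vector. For \<open>j < k\<close> this image stays in
    \<open>W\<close>, so its coordinates from \<open>k\<close> on vanish.\<close>
  have M_zero: "M g $$ (i, j) = 0" if g: "g \<in> carrier G" and ij: "k \<le> i" "i < n" "j < k" for g i j
  proof -
    have "M g $$ (i, j) = (Q * (\<rho> g * P)) $$ (i, j)"
      unfolding M_def using PQ(1,2) rho(1)[OF g] by (simp add: assoc)
    also have "\<dots> = (Q *\<^sub>v col (\<rho> g * P) j) $ i"
      using PQ(1,2) rho(1)[OF g] ij k by simp
    also have "col (\<rho> g * P) j = \<rho> g *\<^sub>v col P j"
      using PQ(1) rho(1)[OF g] ij k by (intro eq_vecI) simp_all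
    also have "(Q *\<^sub>v (\<rho> g *\<^sub>v col P j)) $ i = 0"
      using QW inv g PW ij by blast
    finally show ?thesis .
  qed
  have M_entry: "M (g \<otimes>\<^bsub>G\<^esub> h) $$ (i, j) = (\<Sum>l<k. M g $$ (i, l) * M h $$ (l, j))
      + (\<Sum>l<n-k. M g $$ (i, l + k) * M h $$ (l + k, j))"
    if gh: "g \<in> carrier G" "h \<in> carrier G" and ij: "i < n" "j < n" for g h i j
  proof -
    have "M (g \<otimes>\<^bsub>G\<^esub> h) $$ (i, j) = (\<Sum>l<k+(n-k). M g $$ (i, l) * M h $$ (l, j))"
      unfolding M_mult[OF gh] using M[OF gh(1)] M[OF gh(2)] ij k
      by (simp add: scalar_prod_def atLeast0LessThan)
    then show ?thesis by (simp only: sum_lessThan_add)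
  qed
  define \<rho>\<^sub>1 where "\<rho>\<^sub>1 g = mat k k (\<lambda>(i, j). M g $$ (i, j))" for g
  define \<rho>\<^sub>2 where "\<rho>\<^sub>2 g = mat (n - k) (n - k) (\<lambda>(i, j). M g $$ (i + k, j + k))" for g
  show ?thesis
  proof (rule that[of k \<rho>\<^sub>1 \<rho>\<^sub>2])
    show "k < n" "0 < k" using k k0 kn proper by (auto simp: le_less)
    show "representation G k \<rho>\<^sub>1"
      unfolding representation_iff[OF \<open>group G\<close>]
    proof (intro conjI ballI)
      show "\<rho>\<^sub>1 \<one>\<^bsub>G\<^esub> = 1\<^sub>m k" using k by (intro eq_matI) (simp_all add: \<rho>\<^sub>1_def M_one)
      show "\<rho>\<^sub>1 (g \<otimes>\<^bsub>G\<^esub> h) = \<rho>\<^sub>1 g * \<rho>\<^sub>1 h" if gh: "g \<in> carrier G" "h \<in> carrier G" for g h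
      proof (rule eq_matI)
        fix i j assume "i < dim_row (\<rho>\<^sub>1 g * \<rho>\<^sub>1 h)" "j < dim_col (\<rho>\<^sub>1 g * \<rho>\<^sub>1 h)"
        then have ij: "i < k" "j < k" by (simp_all add: \<rho>\<^sub>1_def)
        \<comment> \<open>Here the vanishing factor comes from \<open>M h\<close>; for the lower
          block below it comes from \<open>M g\<close>.\<close>
        have "(\<Sum>l<n-k. M g $$ (i, l + k) * M h $$ (l + k, j)) = 0"
          using M_zero[OF gh(2)] ij by (intro sum.neutral) simp
        then show "\<rho>\<^sub>1 (g \<otimes>\<^bsub>G\<^esub> h) $$ (i, j) = (\<rho>\<^sub>1 g * \<rho>\<^sub>1 h) $$ (i, j)"
          using M_entry[OF gh, of i j] ij k
          by (simp add: \<rho>\<^sub>1_def scalar_prod_def atLeast0LessThan)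
      qed (simp_all add: \<rho>\<^sub>1_def)
    qed (simp add: \<rho>\<^sub>1_def)
    show "representation G (n - k) \<rho>\<^sub>2"
      unfolding representation_iff[OF \<open>group G\<close>]
    proof (intro conjI ballI)
      show "\<rho>\<^sub>2 \<one>\<^bsub>G\<^esub> = 1\<^sub>m (n - k)" by (intro eq_matI) (simp_all add: \<rho>\<^sub>2_def M_one)
      show "\<rho>\<^sub>2 (g \<otimes>\<^bsub>G\<^esub> h) = \<rho>\<^sub>2 g * \<rho>\<^sub>2 h" if gh: "g \<in> carrier G" "h \<in> carrier G" for g h
      proof (rule eq_matI)
        fix i j assume "i < dim_row (\<rho>\<^sub>2 g * \<rho>\<^sub>2 h)" "j < dim_col (\<rho>\<^sub>2 g * \<rho>\<^sub>2 h)"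
        then have ij: "i < n - k" "j < n - k" by (simp_all add: \<rho>\<^sub>2_def)
        have "(\<Sum>l<k. M g $$ (i + k, l) * M h $$ (l, j + k)) = 0"
          using M_zero[OF gh(1)] ij by (intro sum.neutral) simp
        then show "\<rho>\<^sub>2 (g \<otimes>\<^bsub>G\<^esub> h) $$ (i, j) = (\<rho>\<^sub>2 g * \<rho>\<^sub>2 h) $$ (i, j)"
          using M_entry[OF gh, of "i + k" "j + k"] ij k
          by (simp add: \<rho>\<^sub>2_def scalar_prod_def atLeast0LessThan)
      qed (simp_all add: \<rho>\<^sub>2_def)
    qed (simp add: \<rho>\<^sub>2_def)
    show "\<forall>g\<in>carrier G. mat_trace (\<rho> g) = mat_trace (\<rho>\<^sub>1 g) + mat_trace (\<rho>\<^sub>2 g)"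
    proof
      fix g assume g: "g \<in> carrier G"
      have "mat_trace (\<rho> g) = mat_trace (M g)"
        unfolding M_def using mat_trace_conj[OF rho(1)[OF g] PQ(1-3)] by simp
      also have "\<dots> = (\<Sum>i<k+(n-k). M g $$ (i, i))" using M[OF g] k by (simp add: mat_trace_def)
      also have "\<dots> = mat_trace (\<rho>\<^sub>1 g) + mat_trace (\<rho>\<^sub>2 g)"
        unfolding sum_lessThan_add by (simp add: mat_trace_def \<rho>\<^sub>1_def \<rho>\<^sub>2_def)
      finally show "mat_trace (\<rho> g) = mat_trace (\<rho>\<^sub>1 g) + mat_trace (\<rho>\<^sub>2 g)" .
    qed
  qed
qed

text \<open>Induction on the degree: a reducible representation has the same trace as two
  representations of smaller degree together.\<close>

lemma generalized_character_rep_character: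
  assumes "group G" and "representation G n \<rho>"
  shows "generalized_character G (rep_character G \<rho>)"
  using assms(2)
proof (induction n arbitrary: \<rho> rule: less_induct)
  case (less n)
  consider "n = 0" | "irreducible_representation G n \<rho>" | "0 < n" "\<not> irreducible_representation G n \<rho>"
    by blast
  then show ?case
  proof cases
    \<comment> \<open>An irreducible representation has positive degree by definition, so degree 0
      is handled by the empty combination.\<close>
    case 1
    have "rep_character G \<rho> g = 0" if g: "g \<in> carrier G" for g
    proof -
      have "\<rho> g \<in> carrier_mat 0 0"
        using less.prems 1 g by (simp add: representation_iff[OF assms(1)])
      then show ?thesis using g by (simp add: rep_character_def mat_trace_def)
    qed
    then show ?thesis unfolding generalized_character_def
      by (intro int_combination_on_cong[OF int_combination_on_zero]) simp
  next
    case 2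
    then show ?thesis unfolding generalized_character_def irr_characters_def
      by (intro int_combination_on_member) blast
  next
    case 3
    then obtain W where W: "VectorSpace.subspace class_ring W (module_vec TYPE(complex) n)"
      "\<forall>g\<in>carrier G. \<forall>w\<in>W. \<rho> g *\<^sub>v w \<in> W" "W \<noteq> {0\<^sub>v n}" "W \<noteq> carrier_vec n"
      using less.prems unfolding irreducible_representation_def by blast
    then obtain k \<rho>\<^sub>1 \<rho>\<^sub>2 where k: "k < n" "0 < k"
      and rep: "representation G k \<rho>\<^sub>1" "representation G (n - k) \<rho>\<^sub>2"
      and tr: "\<forall>g\<in>carrier G. mat_trace (\<rho> g) = mat_trace (\<rho>\<^sub>1 g) + mat_trace (\<rho>\<^sub>2 g)"
      using representation_blocks[OF assms(1) less.prems W] by metis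
    have "generalized_character G (\<lambda>g. rep_character G \<rho>\<^sub>1 g + rep_character G \<rho>\<^sub>2 g)"
      using less.IH[OF _ rep(1)] less.IH[OF _ rep(2)] k
      unfolding generalized_character_def by (intro int_combination_on_add) simp_all
    then show ?thesis unfolding generalized_character_def
      by (rule int_combination_on_cong) (simp add: rep_character_def tr)
  qed
qed

section \<open>Permutation characters\<close>

text \<open>The trace of a permutation matrix counts fixed points. The action is on the right
  because it will be right multiplication on right cosets; accordingly row \<open>i\<close> of the
  matrix of \<open>g\<close> has its 1 at the position of the image of \<open>f i\<close>, which
  makes the matrices multiply in the right order.\<close>

lemma permutation_character:
  fixes G (structure)
  assumes "group G" and "finite E"
    and closed: "\<And>x g. \<lbrakk>x \<in> E; g \<in> carrier G\<rbrakk> \<Longrightarrow> act x g \<in> E"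
    and one: "\<And>x. x \<in> E \<Longrightarrow> act x \<one> = x"
    and mult: "\<And>x g h. \<lbrakk>x \<in> E; g \<in> carrier G; h \<in> carrier G\<rbrakk> \<Longrightarrow> act x (g \<otimes> h) = act (act x g) h"
  shows "generalized_character G (\<lambda>g. of_nat (card {x \<in> E. act x g = x}))"
proof -
  obtain f where f: "bij_betw f {..<card E} E"
    using ex_bij_betw_nat_finite[OF \<open>finite E\<close>] by (auto simp: atLeast0LessThan)
  have fE: "f i \<in> E" if "i < card E" for i using f that by (auto simp: bij_betw_def)
  have f_eq: "f i = f j \<longleftrightarrow> i = j" if "i < card E" "j < card E" for i j
    using f that by (auto simp: bij_betw_def inj_on_def)
  define \<rho> where "\<rho> g = mat (card E) (card E) (\<lambda>(i, j). if act (f i) g = f j then 1 else 0 :: complex)" for g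
  have "representation G (card E) \<rho>" unfolding representation_iff[OF \<open>group G\<close>]
  proof (intro conjI ballI)
    show "\<rho> \<one> = 1\<^sub>m (card E)" by (intro eq_matI) (simp_all add: \<rho>_def one fE f_eq)
    show "\<rho> (g \<otimes> h) = \<rho> g * \<rho> h" if gh: "g \<in> carrier G" "h \<in> carrier G" for g h
    proof (rule eq_matI)
      fix i j assume "i < dim_row (\<rho> g * \<rho> h)" "j < dim_col (\<rho> g * \<rho> h)"
      then have ij: "i < card E" "j < card E" by (simp_all add: \<rho>_def)
      obtain m where m: "m < card E" "act (f i) g = f m"
        using closed[OF fE[OF ij(1)] gh(1)] f by (auto simp: bij_betw_def)
      have "(\<rho> g * \<rho> h) $$ (i, j) = (\<Sum>l<card E. \<rho> g $$ (i, l) * \<rho> h $$ (l, j))"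
        using ij by (simp add: \<rho>_def scalar_prod_def atLeast0LessThan)
      also have "\<dots> = (\<Sum>l<card E. if l = m then \<rho> h $$ (l, j) else 0)"
        using ij m by (intro sum.cong) (auto simp: \<rho>_def f_eq)
      also have "\<dots> = \<rho> h $$ (m, j)" using m by simp
      also have "\<dots> = \<rho> (g \<otimes> h) $$ (i, j)"
        using ij m mult[OF fE[OF ij(1)] gh] by (simp add: \<rho>_def)
      finally show "\<rho> (g \<otimes> h) $$ (i, j) = (\<rho> g * \<rho> h) $$ (i, j)" by simp
    qed (simp_all add: \<rho>_def)
  qed (simp add: \<rho>_def)
  then have "generalized_character G (rep_character G \<rho>)"
    by (rule generalized_character_rep_character[OF \<open>group G\<close>])
  moreover have "rep_character G \<rho> g = of_nat (card {x \<in> E. act x g = x})" if g: "g \<in> carrier G" for g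
  proof -
    have "rep_character G \<rho> g = (\<Sum>i<card E. if act (f i) g = f i then 1 else 0)"
      using g by (simp add: rep_character_def mat_trace_def \<rho>_def)
    also have "\<dots> = (\<Sum>x\<in>E. if act x g = x then 1 else 0)"
      by (rule sum.reindex_bij_betw[OF f])
    also have "\<dots> = of_nat (card {x \<in> E. act x g = x})"
      using \<open>finite E\<close> by (simp add: sum.If_cases Int_def)
    finally show ?thesis .
  qed
  ultimately show ?thesis unfolding generalized_character_def
    by (rule int_combination_on_cong)
qed

subsection \<open>Divisibility by the group order\<close>

text \<open>The matrix \<open>S = \<Sum>g\<in>P. \<rho> g\<close> satisfies \<open>S\<^sup>2 = |P| S\<close>, so its trace is a multiple of \<open>|P|\<close>.\<close>

lemma (in group) sum_rep_character_subgroup: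
  assumes P: "subgroup P G" and rep: "representation G n \<rho>"
  obtains m :: nat where "(\<Sum>g\<in>P. rep_character G \<rho> g) = of_nat (card P) * of_nat m"
proof -
  interpret P: subgroup P G by (rule P)
  have rho: "\<And>g. g \<in> carrier G \<Longrightarrow> \<rho> g \<in> carrier_mat n n"
    "\<And>g h. \<lbrakk>g \<in> carrier G; h \<in> carrier G\<rbrakk> \<Longrightarrow> \<rho> (g \<otimes> h) = \<rho> g * \<rho> h"
    using rep unfolding representation_iff[OF is_group] by auto
  define S where "S = mat n n (\<lambda>(i, j). \<Sum>g\<in>P. \<rho> g $$ (i, j))"
  have S: "S \<in> carrier_mat n n" by (simp add: S_def)
  \<comment> \<open>Left translation by \<open>g\<close> permutes \<open>P\<close>, so multiplying
    \<open>S\<close> by \<open>\<rho> g\<close> changes nothing. Summing over \<open>g\<close> gives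
    the factor \<open>card P\<close>.\<close>
  have translate: "(\<Sum>h\<in>P. \<rho> (g \<otimes> h) $$ ij) = (\<Sum>h\<in>P. \<rho> h $$ ij)" if g: "g \<in> P" for g ij
    by (rule sum.reindex_bij_witness[of _ "\<lambda>h. inv g \<otimes> h" "\<lambda>h. g \<otimes> h"])
      (use g in \<open>simp_all add: m_assoc[symmetric]\<close>)
  have "S * S = of_nat (card P) \<cdot>\<^sub>m S"
  proof (rule eq_matI)
    fix i j assume "i < dim_row (of_nat (card P) \<cdot>\<^sub>m S)" "j < dim_col (of_nat (card P) \<cdot>\<^sub>m S)"
    then have ij: "i < n" "j < n" using S by simp_all
    have "(S * S) $$ (i, j) = (\<Sum>l<n. (\<Sum>g\<in>P. \<rho> g $$ (i, l)) * (\<Sum>h\<in>P. \<rho> h $$ (l, j)))"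
      using ij by (simp add: S_def scalar_prod_def atLeast0LessThan)
    also have "\<dots> = (\<Sum>l<n. \<Sum>g\<in>P. \<Sum>h\<in>P. \<rho> g $$ (i, l) * \<rho> h $$ (l, j))"
      by (simp only: sum_product)
    also have "\<dots> = (\<Sum>g\<in>P. \<Sum>l<n. \<Sum>h\<in>P. \<rho> g $$ (i, l) * \<rho> h $$ (l, j))"
      by (rule sum.swap)
    also have "\<dots> = (\<Sum>g\<in>P. \<Sum>h\<in>P. \<Sum>l<n. \<rho> g $$ (i, l) * \<rho> h $$ (l, j))"
      by (intro sum.cong refl sum.swap)
    also have "\<dots> = (\<Sum>g\<in>P. \<Sum>h\<in>P. \<rho> (g \<otimes> h) $$ (i, j))"
    proof (intro sum.cong refl)
      fix g h assume "g \<in> P" "h \<in> P"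
      then have gh: "g \<in> carrier G" "h \<in> carrier G" by simp_all
      show "(\<Sum>l<n. \<rho> g $$ (i, l) * \<rho> h $$ (l, j)) = \<rho> (g \<otimes> h) $$ (i, j)"
        unfolding rho(2)[OF gh] using rho(1)[OF gh(1)] rho(1)[OF gh(2)] ij
        by (simp add: scalar_prod_def atLeast0LessThan)
    qed
    also have "\<dots> = of_nat (card P) * (\<Sum>h\<in>P. \<rho> h $$ (i, j))"
      by (simp add: translate)
    finally show "(S * S) $$ (i, j) = (of_nat (card P) \<cdot>\<^sub>m S) $$ (i, j)"
      using ij by (simp add: S_def)
  qed (simp_all add: S_def)
  \<comment> \<open>For finite \<open>P\<close>, S / |P| is the projection onto the vectors fixed by
    \<open>P\<close>, and \<open>m\<close> is the dimension of its image.\<close>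
  then obtain m :: nat where m: "mat_trace S = of_nat (card P) * of_nat m"
    using mat_trace_square_eq_smult[OF S] by metis
  have "mat_trace S = (\<Sum>i<n. \<Sum>g\<in>P. \<rho> g $$ (i, i))" by (simp add: mat_trace_def S_def)
  also have "\<dots> = (\<Sum>g\<in>P. \<Sum>i<n. \<rho> g $$ (i, i))" by (rule sum.swap)
  also have "\<dots> = (\<Sum>g\<in>P. rep_character G \<rho> g)"
  proof (intro sum.cong refl)
    fix g assume "g \<in> P"
    then have g: "g \<in> carrier G" by simp
    show "(\<Sum>i<n. \<rho> g $$ (i, i)) = rep_character G \<rho> g"
      using rho(1)[OF g] g by (simp add: rep_character_def mat_trace_def)
  qed
  finally show ?thesis using m by (intro that[of m]) metis
qed

text \<open>Linear extension of the previous lemma. For finite \<open>P\<close> the integer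
  \<open>z\<close> is the inner product of the restriction of \<open>f\<close> to \<open>P\<close>
  with the trivial character.\<close>

lemma (in group) sum_generalized_character_subgroup:
  assumes P: "subgroup P G" and f: "generalized_character G f"
  obtains z :: int where "(\<Sum>g\<in>P. f g) = of_nat (card P) * of_int z"
proof -
  obtain S and c :: "('a \<Rightarrow> complex) \<Rightarrow> int" where S: "S \<subseteq> irr_characters G"
    and f: "\<forall>g\<in>carrier G. f g = (\<Sum>\<chi>\<in>S. of_int (c \<chi>) * \<chi> g)"
    using f unfolding generalized_character_def int_combination_on_def by metis
  have "\<exists>m::nat. (\<Sum>g\<in>P. \<chi> g) = of_nat (card P) * of_nat m" if \<chi>: "\<chi> \<in> S" for \<chi>
  proof -
    obtain n \<rho> where "\<chi> = rep_character G \<rho>" "representation G n \<rho>"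
      using S \<chi> unfolding irr_characters_def irreducible_representation_def by blast
    then show ?thesis using sum_rep_character_subgroup[OF P] by metis
  qed
  then obtain m :: "('a \<Rightarrow> complex) \<Rightarrow> nat"
    where m: "\<And>\<chi>. \<chi> \<in> S \<Longrightarrow> (\<Sum>g\<in>P. \<chi> g) = of_nat (card P) * of_nat (m \<chi>)"
    by metis
  have "(\<Sum>g\<in>P. f g) = (\<Sum>g\<in>P. \<Sum>\<chi>\<in>S. of_int (c \<chi>) * \<chi> g)"
    using f subgroup.subset[OF P] by (intro sum.cong) auto
  also have "\<dots> = (\<Sum>\<chi>\<in>S. \<Sum>g\<in>P. of_int (c \<chi>) * \<chi> g)" by (rule sum.swap)
  also have "\<dots> = (\<Sum>\<chi>\<in>S. of_int (c \<chi>) * (of_nat (card P) * of_nat (m \<chi>)))"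
    by (intro sum.cong refl) (simp add: m flip: sum_distrib_left)
  also have "\<dots> = of_nat (card P) * of_int (\<Sum>\<chi>\<in>S. c \<chi> * int (m \<chi>))"
    by (simp add: sum_distrib_left mult_ac)
  finally show ?thesis by (rule that)
qed

section \<open>Sylow subgroups and the lower bound\<close>

text \<open>Every nonidentity element of \<open>P\<close> has order a positive power of
  \<open>p\<close>, while the identity contributes exactly 1.\<close>

lemma (in group) coprime_sum_ord_p_subgroup:
  assumes P: "subgroup P G" and p: "prime (p::nat)" and card: "card P = p ^ a"
  shows "coprime (\<Sum>g\<in>P. ord g) p"
proof -
  interpret P: subgroup P G by (rule P)
  interpret PG: group "G\<lparr>carrier := P\<rparr>" using P by (rule subgroup_imp_group)
  \<comment> \<open>An infinite set has cardinality 0 by convention, and a power of a prime is not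
    0.\<close>
  have fin: "finite P" using card p by (metis card.infinite power_eq_0_iff not_prime_0)
  have "p dvd ord g" if g: "g \<in> P - {\<one>}" for g
  proof -
    have "g [^] card P = \<one>"
      using PG.pow_order_eq_1[of g] g by (simp add: Coset.order_def flip: nat_pow_consistent)
    then have "ord g dvd p ^ a" using g card pow_eq_id[of g] by auto
    then obtain i where i: "ord g = p ^ i" using divides_primepow_nat[OF p] by blast
    moreover have "ord g \<noteq> 1" using g ord_eq_1[of g] by auto
    ultimately show ?thesis by (cases i) simp_all
  qed
  then obtain k where k: "(\<Sum>g\<in>P - {\<one>}. ord g) = p * k" using dvd_sum dvdE by metis
  have "(\<Sum>g\<in>P. ord g) = k * p + 1"
    using sum.remove[OF fin P.one_closed, of ord] k by simp
  then show ?thesis by (simp only: coprime_iff_gcd_eq_1 gcd_add_mult gcd.commute) simp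
qed

lemma (in group) order_dvd_if_generalized_character:
  assumes fin: "finite (carrier G)"
    and gen: "generalized_character G (\<lambda>g. of_nat m * of_nat (ord g))"
  shows "Coset.order G dvd m"
\<comment> \<open>\<open>multiplicity p 0\<close> is 0 by convention, so the comparison of
  multiplicities has to leave out \<open>m = 0\<close>, where divisibility is trivial.\<close>
proof (cases "m = 0")
  case False
  have order_pos: "Coset.order G \<noteq> 0" using fin order_gt_0_iff_finite by simp
  show ?thesis
  proof (rule multiplicity_le_imp_dvd[OF order_pos])
    fix p :: nat assume p: "prime p"
    define a where "a = multiplicity p (Coset.order G)"
    obtain r where r: "Coset.order G = p ^ a * r" using multiplicity_dvd[of p] unfolding a_def by blast
    obtain P where P: "subgroup P G" and cardP: "card P = p ^ a"
      using sylow_thm[OF p is_group r fin] by blast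
    obtain z :: int where z: "(\<Sum>g\<in>P. of_nat m * of_nat (ord g)) = (of_nat (card P) * of_int z :: complex)"
      using sum_generalized_character_subgroup[OF P gen] by blast
    \<comment> \<open>The identity between complex numbers is brought into the form of an equation
      between embedded integers, so that injectivity of the embedding gives divisibility in the
      integers.\<close>
    have "(of_int (int (m * (\<Sum>g\<in>P. ord g))) :: complex) = (\<Sum>g\<in>P. of_nat m * of_nat (ord g))"
      by (simp add: sum_distrib_left)
    also have "\<dots> = of_int (int (p ^ a) * z)" unfolding z by (simp add: cardP)
    finally have "int (m * (\<Sum>g\<in>P. ord g)) = int (p ^ a) * z" by (simp only: of_int_eq_iff)
    then have "int (p ^ a) dvd int (m * (\<Sum>g\<in>P. ord g))" by simp
    then have "p ^ a dvd m * (\<Sum>g\<in>P. ord g)" by (simp only: int_dvd_int_iff)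
    moreover have "coprime (p ^ a) (\<Sum>g\<in>P. ord g)"
      using coprime_sum_ord_p_subgroup[OF P p cardP] by (simp add: coprime_commute)
    ultimately have "p ^ a dvd m" by (simp add: coprime_dvd_mult_left_iff)
    then show "multiplicity p (Coset.order G) \<le> multiplicity p m"
      unfolding a_def[symmetric] using False p not_prime_unit by (intro multiplicity_geI) auto
  qed
qed simp

subsection \<open>Characters induced from cyclic subgroups\<close>

text \<open>This count of conjugating elements is the common form in which induced characters are
  compared with fixed cosets and with \<open>artin_function\<close>.\<close>

lemma (in group) induced_trivial_character:
  assumes fin: "finite (carrier G)" and g: "g \<in> carrier G"
  shows "induced_character G C (trivial_character C) g =
    of_nat (card {x \<in> carrier G. x \<otimes> g \<otimes> inv x \<in> C}) / of_nat (card C)"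
proof -
  have "induced_character G C (trivial_character C) g =
      (\<Sum>x\<in>carrier G. if x \<otimes> g \<otimes> inv x \<in> C then 1 else 0) / of_nat (card C)"
    using g by (simp add: induced_character_def trivial_character_def Let_def cong: if_cong)
  also have "(\<Sum>x\<in>carrier G. if x \<otimes> g \<otimes> inv x \<in> C then 1 else 0 :: complex) =
      of_nat (card {x \<in> carrier G. x \<otimes> g \<otimes> inv x \<in> C})"
    using fin by (simp add: sum.If_cases Int_def)
  finally show ?thesis .
qed

text \<open>(1_C)^G is the permutation character of G on the right cosets of C: the coset C x is
  fixed by g exactly when x g x^-1 lies in C.\<close>

lemma (in group) generalized_character_induced_trivial:
  assumes fin: "finite (carrier G)" and C: "subgroup C G"
  shows "generalized_character G (induced_character G C (trivial_character C))"
proof -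
  interpret C: subgroup C G by (rule C)
  have rcosetsD: "D \<subseteq> carrier G" if "D \<in> rcosets C" for D
    using that rcosets_part_G[OF C] by blast
  have fin_rcosets: "finite (rcosets C)"
    using rcosets_subset_PowG[OF C] fin by (meson finite_Pow_iff finite_subset)
  have "generalized_character G (\<lambda>g. of_nat (card {D \<in> rcosets C. D #> g = D}))"
  proof (rule permutation_character[OF is_group fin_rcosets])
    show "D #> g \<in> rcosets C" if "D \<in> rcosets C" "g \<in> carrier G" for D g
      using that by (auto simp: RCOSETS_def coset_mult_assoc C.subset)
    show "D #> \<one> = D" if "D \<in> rcosets C" for D
      using rcosetsD[OF that] by (rule coset_mult_one)
    show "D #> (g \<otimes> h) = D #> g #> h" if "D \<in> rcosets C" "g \<in> carrier G" "h \<in> carrier G" for D g h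
      using coset_mult_assoc[OF rcosetsD] that by simp
  qed
  moreover have "of_nat (card {D \<in> rcosets C. D #> g = D}) = induced_character G C (trivial_character C) g"
    if g: "g \<in> carrier G" for g
  proof -
    let ?F = "{D \<in> rcosets C. D #> g = D}"
    have fixed_iff: "C #> x #> g = C #> x \<longleftrightarrow> x \<otimes> g \<otimes> inv x \<in> C" if x: "x \<in> carrier G" for x
    proof
      assume "C #> x #> g = C #> x"
      then have "C #> (x \<otimes> g) = C #> x" using x g by (simp add: coset_mult_assoc C.subset)
      then have "C #> (x \<otimes> g \<otimes> inv x) = C" using x g by (intro coset_mult_inv2) (simp_all add: C.subset)
      then show "x \<otimes> g \<otimes> inv x \<in> C" using x g by (intro coset_join1[OF _ _ C]) simp_all
    next
      assume "x \<otimes> g \<otimes> inv x \<in> C"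
      then have "C #> (x \<otimes> g \<otimes> inv x) = C" using x g by (intro coset_join2[OF _ C]) simp_all
      then have "C #> (x \<otimes> g) = C #> x" using x g by (intro coset_mult_inv1) (simp_all add: C.subset)
      then show "C #> x #> g = C #> x" using x g by (simp add: coset_mult_assoc C.subset)
    qed
    \<comment> \<open>The elements counted by the induced character fill up exactly the fixed
      cosets. Each of these has |C| elements, which accounts for the denominator in the induction
      formula.\<close>
    have "\<Union>?F = {x \<in> carrier G. x \<otimes> g \<otimes> inv x \<in> C}"
    proof (intro subset_antisym subsetI)
      fix x assume "x \<in> \<Union>?F"
      then obtain D where D: "D \<in> rcosets C" "D #> g = D" "x \<in> D" by blast
      then have x: "x \<in> carrier G" using rcosetsD by blast
      obtain y where y: "y \<in> carrier G" "D = C #> y" using D(1) by (auto simp: RCOSETS_def)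
      then have "D = C #> x" using repr_independence[of x C y] D(3) C by simp
      then show "x \<in> {x \<in> carrier G. x \<otimes> g \<otimes> inv x \<in> C}" using fixed_iff x D(2) by simp
    next
      fix x assume "x \<in> {x \<in> carrier G. x \<otimes> g \<otimes> inv x \<in> C}"
      then show "x \<in> \<Union>?F"
        using fixed_iff[of x] rcos_self[of x C] C by (auto simp: RCOSETS_def)
    qed
    moreover have "card C * card ?F = card (\<Union>?F)"
    proof (rule card_partition)
      show "finite ?F" using fin_rcosets by simp
      show "finite (\<Union>?F)" by (rule finite_subset[OF _ fin]) (use rcosetsD in blast)
      show "card D = card C" if "D \<in> ?F" for D
        using that card_rcosets_equal[of D C] C.subset by auto
      show "D \<inter> D' = {}" if "D \<in> ?F" "D' \<in> ?F" "D \<noteq> D'" for D D'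
        using that rcos_disjoint[OF C] by (simp add: pairwise_def disjnt_def)
    qed
    moreover have card_C: "card C \<noteq> 0"
      using C.one_closed finite_subset[OF C.subset fin] unfolding card_eq_0_iff by blast
    ultimately have "of_nat (card C) * of_nat (card ?F) =
        (of_nat (card {x \<in> carrier G. x \<otimes> g \<otimes> inv x \<in> C}) :: complex)"
      by (simp flip: of_nat_mult)
    then show ?thesis
      using card_C by (simp add: induced_trivial_character[OF fin g] field_simps)
  qed
  ultimately show ?thesis unfolding generalized_character_def by (rule int_combination_on_cong)
qed

section \<open>Cyclic subgroups generated by conjugates\<close>

lemma (in group) generate_in_cyclic_subgroups:
  assumes y: "y \<in> carrier G"
  shows "generate G {y} \<in> cyclic_subgroups G"
proof -
  have "cyclic_group (subgroup_generated G {y})" by (rule cyclic_group_generated)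
  moreover have "subgroup_generated G {y} = G\<lparr>carrier := generate G {y}\<rparr>"
    using y by (simp add: subgroup_generated_def)
  ultimately show ?thesis
    using y generate_is_subgroup[of "{y}"] by (simp add: cyclic_subgroups_def)
qed

lemma (in group) ord_conjugate:
  assumes "x \<in> carrier G" "g \<in> carrier G"
  shows "ord (x \<otimes> g \<otimes> inv x) = ord g"
proof -
  have pow: "(x \<otimes> g \<otimes> inv x) [^] n = x \<otimes> (g [^] n) \<otimes> inv x" for n :: nat
  proof (induction n)
    case (Suc n)
    have "(x \<otimes> g \<otimes> inv x) [^] Suc n = (x \<otimes> (g [^] n) \<otimes> inv x) \<otimes> (x \<otimes> g \<otimes> inv x)"
      by (simp only: nat_pow_Suc Suc)
    also have "\<dots> = x \<otimes> (g [^] n) \<otimes> (inv x \<otimes> x) \<otimes> g \<otimes> inv x"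
      using assms by (simp only: m_assoc m_closed inv_closed nat_pow_closed)
    finally show ?case using assms by (simp add: m_assoc)
  qed (use assms in simp)
  have conj_one: "x \<otimes> h \<otimes> inv x = \<one> \<longleftrightarrow> h = \<one>" if h: "h \<in> carrier G" for h
  proof
    assume eq: "x \<otimes> h \<otimes> inv x = \<one>"
    have "x \<otimes> h = x \<otimes> h \<otimes> inv x \<otimes> x" using assms(1) h by (simp add: m_assoc)
    also have "\<dots> = x" unfolding eq using assms(1) by simp
    finally show "h = \<one>" using assms(1) h by simp
  qed (use assms in simp)
  \<comment> \<open>The order of an element is determined by the set of exponents that kill
    it.\<close>
  have "(x \<otimes> g \<otimes> inv x) [^] n = \<one> \<longleftrightarrow> ord g dvd n" for n :: nat
    unfolding pow using conj_one[of "g [^] n"] pow_eq_id[of g n] assms by simp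
  then show ?thesis using ord_unique[of "x \<otimes> g \<otimes> inv x"] assms by simp
qed

text \<open>This is Artin's class function on \<open>C\<close> (\<open>|C|\<close> on generators, zero elsewhere), induced to \<open>G\<close>.\<close>

definition (in group) artin_function :: "'a set \<Rightarrow> 'a \<Rightarrow> nat" where
  "artin_function C g = card {x \<in> carrier G. generate G {x \<otimes> g \<otimes> inv x} = C}"

lemma (in group) finite_cyclic_subgroups:
  assumes "finite (carrier G)"
  shows "finite (cyclic_subgroups G)"
proof (rule finite_subset)
  show "cyclic_subgroups G \<subseteq> Pow (carrier G)"
    by (auto simp: cyclic_subgroups_def dest: subgroup.subset)
qed (use assms in simp)

text \<open>The elements x on the right are sorted by the subgroup that x g x^-1 generates; this
  subgroup lies in \<open>C\<close> exactly when the conjugate does.\<close>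

lemma (in group) sum_artin_function:
  assumes fin: "finite (carrier G)" and C: "subgroup C G" and g: "g \<in> carrier G"
  shows "(\<Sum>B\<in>{B \<in> cyclic_subgroups G. B \<subseteq> C}. artin_function B g) =
    card {x \<in> carrier G. x \<otimes> g \<otimes> inv x \<in> C}"
proof -
  let ?X = "{x \<in> carrier G. x \<otimes> g \<otimes> inv x \<in> C}" and ?\<B> = "{B \<in> cyclic_subgroups G. B \<subseteq> C}"
  let ?h = "\<lambda>x. generate G {x \<otimes> g \<otimes> inv x}"
  have "card ?X = (\<Sum>x\<in>?X. 1)" by simp
  also have "\<dots> = (\<Sum>B\<in>?\<B>. \<Sum>x\<in>{x \<in> ?X. ?h x = B}. 1)"
  proof (rule sum.group[symmetric])
    show "?h ` ?X \<subseteq> ?\<B>"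
    proof (rule image_subsetI)
      fix x assume "x \<in> ?X"
      then show "?h x \<in> ?\<B>"
        using g generate_in_cyclic_subgroups[of "x \<otimes> g \<otimes> inv x"]
          generate_subgroup_incl[of "{x \<otimes> g \<otimes> inv x}", OF _ C] by simp
    qed
  qed (use fin finite_cyclic_subgroups in simp_all)
  also have "\<dots> = (\<Sum>B\<in>?\<B>. artin_function B g)"
  proof (rule sum.cong[OF refl])
    fix B assume "B \<in> ?\<B>"
    then have "{x \<in> ?X. ?h x = B} = {x \<in> carrier G. ?h x = B}"
      using generate.incl[of _ "{_}" G] by auto
    then show "(\<Sum>x\<in>{x \<in> ?X. ?h x = B}. 1) = artin_function B g" by (simp add: artin_function_def)
  qed
  finally show ?thesis by simp
qed

lemma (in group) int_combination_on_artin_function: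
  assumes fin: "finite (carrier G)" and C: "C \<in> cyclic_subgroups G"
  shows "int_combination_on (carrier G)
    {induced_character G C (trivial_character C) | C. C \<in> cyclic_subgroups G}
    (\<lambda>g. of_nat (artin_function C g))" (is "int_combination_on _ ?X _")
  using C
proof (induction "card C" arbitrary: C rule: less_induct)
  case less
  then have C: "subgroup C G" by (simp add: cyclic_subgroups_def)
  have finC: "finite C" using fin subgroup.subset[OF C] finite_subset by blast
  let ?\<B> = "{B \<in> cyclic_subgroups G. B \<subset> C}"
  have "int_combination_on (carrier G) ?X (\<lambda>g. of_nat (artin_function B g))" if "B \<in> ?\<B>" for B
    using that less.hyps[of B] psubset_card_mono[OF finC, of B] by simp
  moreover have "int_combination_on (carrier G) ?X (induced_character G C (trivial_character C))"
    using less.prems by (intro int_combination_on_member) blast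
  \<comment> \<open>The sum formula is solved for its term B = C, which occurs because
    \<open>C\<close> is itself cyclic. The factor \<open>card C\<close> clears the denominator of
    the induced character, so all coefficients are integers.\<close>
  ultimately have "int_combination_on (carrier G) ?X
      (\<lambda>g. of_int (int (card C)) * induced_character G C (trivial_character C) g
        + of_int (-1) * (\<Sum>B\<in>?\<B>. of_nat (artin_function B g)))"
    by (intro int_combination_on_add int_combination_on_cmult int_combination_on_sum)
  then show ?case
  proof (rule int_combination_on_cong)
    fix g assume g: "g \<in> carrier G"
    have "{B \<in> cyclic_subgroups G. B \<subseteq> C} = insert C ?\<B>" using less.prems by auto
    then have "card {x \<in> carrier G. x \<otimes> g \<otimes> inv x \<in> C} =
        artin_function C g + (\<Sum>B\<in>?\<B>. artin_function B g)"
      using sum_artin_function[OF fin C g] finite_cyclic_subgroups[OF fin] by simp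
    moreover have "card C \<noteq> 0" using finC subgroup.one_closed[OF C] by auto
    ultimately show "of_int (int (card C)) * induced_character G C (trivial_character C) g
        + of_int (-1) * (\<Sum>B\<in>?\<B>. of_nat (artin_function B g)) = of_nat (artin_function C g)"
      by (simp add: induced_trivial_character[OF fin g])
  qed
qed

lemma (in group) int_combination_on_Xi:
  assumes fin: "finite (carrier G)"
  shows "int_combination_on (carrier G)
    {induced_character G C (trivial_character C) | C. C \<in> cyclic_subgroups G} (Xi G)"
    (is "int_combination_on _ ?X _")
proof -
  have "int_combination_on (carrier G) ?X
      (\<lambda>g. \<Sum>C\<in>cyclic_subgroups G. of_int (int (card C)) * of_nat (artin_function C g))"
    by (intro int_combination_on_sum int_combination_on_cmult int_combination_on_artin_function fin)
  then show ?thesis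
  proof (rule int_combination_on_cong)
    fix g assume g: "g \<in> carrier G"
    let ?h = "\<lambda>x. generate G {x \<otimes> g \<otimes> inv x}"
    have "Coset.order G * ord g = (\<Sum>x\<in>carrier G. ord (x \<otimes> g \<otimes> inv x))"
      using g by (simp add: ord_conjugate Coset.order_def)
    \<comment> \<open>The order of an element is the size of the subgroup it generates. Hence the
      summand depends only on that subgroup, and grouping by it produces the weights
      \<open>card C\<close>.\<close>
    also have "\<dots> = (\<Sum>x\<in>carrier G. card (?h x))"
      using g by (intro sum.cong) (simp_all add: generate_pow_card)
    also have "\<dots> = (\<Sum>C\<in>cyclic_subgroups G. \<Sum>x\<in>{x \<in> carrier G. ?h x = C}. card (?h x))"
    proof (rule sum.group[symmetric])
      show "?h ` carrier G \<subseteq> cyclic_subgroups G" using g generate_in_cyclic_subgroups by auto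
    qed (use fin finite_cyclic_subgroups in simp_all)
    also have "\<dots> = (\<Sum>C\<in>cyclic_subgroups G. card C * artin_function C g)"
      by (intro sum.cong) (simp_all add: artin_function_def)
    finally have "(of_nat (Coset.order G * ord g) :: complex) =
        of_nat (\<Sum>C\<in>cyclic_subgroups G. card C * artin_function C g)" by simp
    then show "(\<Sum>C\<in>cyclic_subgroups G. of_int (int (card C)) * of_nat (artin_function C g)) = Xi G g"
      by (simp add: Xi_def)
  qed
qed

theorem theoremA:
  fixes G :: "('a, 'b) monoid_scheme"
  assumes "group G" and "finite (carrier G)"
  shows "(0 < Coset.order G
          \<and> generalized_character G (\<lambda>g. of_nat (Coset.order G) * of_nat (group.ord G g))
          \<and> (\<forall>m::nat. 0 < m \<longrightarrow> generalized_character G (\<lambda>g. of_nat m * of_nat (group.ord G g))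
               \<longrightarrow> Coset.order G \<le> m))
       \<and> int_combination_on (carrier G)
           {induced_character G C (trivial_character C) | C. C \<in> cyclic_subgroups G} (Xi G)"
proof -
  interpret group G by fact
  note fin = \<open>finite (carrier G)\<close>
  have "int_combination_on (carrier G) (irr_characters G) (Xi G)"
  \<comment> \<open>That |G| itself is admissible follows from the sharper statement about cyclic
    subgroups.\<close>
  proof (rule int_combination_on_trans[OF int_combination_on_Xi[OF fin]])
    show "int_combination_on (carrier G) (irr_characters G) \<chi>"
      if "\<chi> \<in> {induced_character G C (trivial_character C) | C. C \<in> cyclic_subgroups G}" for \<chi>
      using that generalized_character_induced_trivial[OF fin]
      unfolding generalized_character_def cyclic_subgroups_def by blast
  qed
  then have "generalized_character G (\<lambda>g. of_nat (Coset.order G) * of_nat (ord g))"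
    unfolding generalized_character_def by (rule int_combination_on_cong) (simp add: Xi_def)
  moreover have "Coset.order G \<le> m"
    if "0 < m" "generalized_character G (\<lambda>g. of_nat m * of_nat (ord g))" for m
    using order_dvd_if_generalized_character[OF fin that(2)] that(1) by (rule dvd_imp_le)
  moreover have "0 < Coset.order G" using fin order_gt_0_iff_finite by simp
  ultimately show ?thesis using int_combination_on_Xi[OF fin] by blast
qed

end
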